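(* For each integer $k \ge 2$ there is a bijection $\Omega_{\alpha,k} : \mathcal{P} \to \mathcal{W}_k$ such that, for every $\lambda\in\mathcal{P}$, if $w = \Omega_{\alpha,k}(\lambda)$ and $a_i$ denotes the number of occurrences of the letter $i$ in $w$, then: (1) $\lambda$ contains exactly $a_i$ parts congruent to $i$ modulo $k-1$, for each $1 \le i < k$; (2) $|\lambda| = (k-1)\,\mathrm{comaj}(w) - \sum_{i=1}^{k-2} (k-1-i)\,a_i$; (3) $\mu_k(\lambda) = \mathrm{asc}(w)$.
   Context: $\mathcal{P}$ is the set of all integer partitions (including the empty partition): weakly decreasing sequences $\lambda=(\lambda_1,\lambda_2,\ldots)$ of nonnegative integers with finite sum $|\lambda| = \sum_i \lambda_i$. The nonzero $\lambda_i$ are the parts of $\lambda$, counted with multiplicity. The $k$-measure $\mu_k(\lambda)$ is the maximal length $m$ of a sequence of indices $i_1<\cdots<i_m$ of parts (nonzero entries) of $\lambda$ such that $\lambda_{i_j}-\lambda_{i_{j+1}} \ge k$ for all $1\le j<m$ (so $\mu_k$ of the empty partition is $0$). $\mathcal{W}_k$ is the set of finite words $w=w_1\cdots w_n$ ($n\ge 1$) on the alphabet $\{1,\ldots,k\}$ that end with a single $k$, i.e. $w_n = k$ and, if $n\ge 2$, $w_{n-1}\ne k$. An ascent of $w=w_1\cdots w_n$ is an index $1\le i<n$ with $w_i<w_{i+1}$. $\mathrm{asc}(w)$ is the number of ascents of $w$ and $\mathrm{comaj}(w)$ is the sum of all ascents of $w$. *)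

theory Defs
  imports Complex_Main "HOL-Number_Theory.Cong"
begin

text \<open>Partitions are weakly decreasing sequences \<open>l 0 \<ge> l 1 \<ge> \<dots>\<close> of naturals, indexed from 0. For
  natural numbers, finite sum means finite support.\<close>

definition partitions :: "(nat \<Rightarrow> nat) set" where
  "partitions = {l. antimono l \<and> finite {i. l i \<noteq> 0}}"

definition psize :: "(nat \<Rightarrow> nat) \<Rightarrow> nat" where
  "psize l = (\<Sum>i | l i \<noteq> 0. l i)"

definition num_parts_cong :: "nat \<Rightarrow> nat \<Rightarrow> (nat \<Rightarrow> nat) \<Rightarrow> nat" where
  "num_parts_cong i m l = card {j. l j \<noteq> 0 \<and> [l j = i] (mod m)}"

text \<open>An admissible list \<open>js\<close> consists of the indices \<open>i\<^sub>1 < \<dots> < i\<^sub>m\<close> of a sequence of parts with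
  successive differences at least \<open>k\<close> (stated additively, since subtraction on \<open>nat\<close> truncates).
  The maximum is over a nonempty set, as \<open>[]\<close> is admissible, and over a finite one if \<open>l\<close> has
  finite support.\<close>

definition k_admissible :: "nat \<Rightarrow> (nat \<Rightarrow> nat) \<Rightarrow> nat list \<Rightarrow> bool" where
  "k_admissible k l js \<longleftrightarrow>
     sorted_wrt (<) js \<and> (\<forall>j\<in>set js. l j \<noteq> 0) \<and>
     (\<forall>j. Suc j < length js \<longrightarrow> l (js ! j) \<ge> l (js ! Suc j) + k)"

definition k_measure :: "nat \<Rightarrow> (nat \<Rightarrow> nat) \<Rightarrow> nat" where
  "k_measure k l = Max {length js | js. k_admissible k l js}"

definition words :: "nat \<Rightarrow> nat list set" where
  "words k = {w. w \<noteq> [] \<and> set w \<subseteq> {1..k} \<and> last w = k \<and>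
                 (length w \<ge> 2 \<longrightarrow> w ! (length w - 2) \<noteq> k)}"

text \<open>Ascents are positions counted from 1, whereas list indexing starts at 0.\<close>

definition ascents :: "nat list \<Rightarrow> nat set" where
  "ascents w = {i. 1 \<le> i \<and> i < length w \<and> w ! (i - 1) < w ! i}"

definition asc :: "nat list \<Rightarrow> nat" where
  "asc w = card (ascents w)"

definition comaj :: "nat list \<Rightarrow> nat" where
  "comaj w = \<Sum>(ascents w)"

end

theory Submission
  imports Defs
begin

text \<open>
  Write \<open>k = d + 1\<close>. The bijection is built from the side of the words: reading a word from right to
  left, each letter acts on a partition, starting from the empty one, and the partition obtained
  at the end is the image of the word.

  The basic operation shifts a chain. In a finite multiset of integers select greedily from below:
  take the smallest element \<open>c\<^sub>1\<close>, then the smallest element \<open>c\<^sub>2 \<ge> c\<^sub>1 + k\<close>, then the smallest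
  \<open>c\<^sub>3 \<ge> c\<^sub>2 + k\<close>, and so on; then add \<open>d\<close> to all selected elements. The elements that lie between
  \<open>c\<^sub>i\<close> and \<open>c\<^sub>i\<^sub>+\<^sub>1\<close> are at most \<open>c\<^sub>i + d\<close>, so afterwards the shifted elements are exactly the ones selected
  greedily from above (the largest element, then the largest element that is smaller by at least
  \<open>k\<close>, etc.). Hence the operation is undone by the greedy selection from above, followed by
  subtracting \<open>d\<close>. It keeps all residues modulo \<open>d\<close>. Both greedy selections yield a chain of maximal
  length, so the operation keeps \<open>\<mu>\<^sub>k\<close> and adds \<open>d \<mu>\<^sub>k\<close> to the sum.

  The letter \<open>k\<close> acts by the chain shift alone; a letter \<open>x < k\<close> first inserts the element
  \<open>x - d \<le> 0\<close>, which becomes the first selected one and is moved to \<open>x\<close>. Conversely, undoing the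
  chain shift on a nonempty partition produces at most one element \<open>\<le> 0\<close>, because only the lowest
  element of the chain can fall that far. This element tells which letter acted last, and it is the
  letter \<open>k\<close> if there is none. The partition that remains has a smaller sum, so every partition is
  reached exactly once. The letter \<open>k\<close> fixes the empty partition, whence the condition that words
  end with a single \<open>k\<close>.

  The letter \<open>x < k\<close> contributes one part that is congruent to \<open>x\<close>. It raises \<open>\<mu>\<^sub>k\<close> by one iff
  \<open>x - d\<close> lies at distance at least \<open>k\<close> below the lowest element \<open>b\<close> of the chain selected from above,
  that is, iff \<open>x < b\<close>. The preceding action has left \<open>b\<close> equal to its letter \<open>y\<close> if \<open>y < k\<close>, and
  \<open>b \<ge> k\<close> if \<open>y = k\<close> (put \<open>b = \<infinity>\<close> for the empty partition), so \<open>\<mu>\<^sub>k\<close> grows iff \<open>x < y\<close>, that is, iff prepending \<open>x\<close> to a word that starts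
  with \<open>y\<close> creates an ascent (\<open>chain_length_parts_of\<close>). Finally, prepending a letter moves all ascents
  by one, so it increases \<open>comaj\<close> by the new number of ascents, while the sum of the partition
  grows by \<open>d \<mu>\<^sub>k\<close>, plus \<open>x - d\<close> if \<open>x < k\<close>. This is the formula for the size.
\<close>

section \<open>Shifting a greedy chain\<close>

text \<open>
  The chain shift on ascending lists: \<open>push d e xs\<close> is the result for the list \<open>(e - d) # xs\<close>. The
  shifted chain element \<open>e\<close> is carried along until the first entry that is at least \<open>e - d + k\<close>, that is,
  larger than \<open>e\<close>; this entry is the next chain element, so \<open>e\<close> is put down in front of it and the
  entry is picked up, raised by \<open>d\<close>. Passing \<open>e\<close> instead of \<open>e - d\<close> keeps all entries natural, although
  the element inserted by a letter may be negative.
\<close>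
fun push :: "nat \<Rightarrow> nat \<Rightarrow> nat list \<Rightarrow> nat list" where
  "push d e [] = [e]"
| "push d e (x # xs) = (if x \<le> e then x # push d e xs else e # push d (x + d) xs)"

text \<open>
  For an ascending list, \<open>bottom\<close> and \<open>chain_length\<close> are the lowest element and the length of the chain
  that is selected greedily from above. Both scan the list from its right end: the entry \<open>x\<close> joins the
  chain iff it is smaller than the lowest element so far by at least \<open>d + 1\<close>.
\<close>
fun bottom :: "nat \<Rightarrow> nat list \<Rightarrow> nat" where
  "bottom d [] = 0"
| "bottom d (x # xs) = (if xs = [] \<or> x + d < bottom d xs then x else bottom d xs)"

fun chain_length :: "nat \<Rightarrow> nat list \<Rightarrow> nat" where
  "chain_length d [] = 0"
| "chain_length d (x # xs) =
     (if xs = [] \<or> x + d < bottom d xs then Suc (chain_length d xs) else chain_length d xs)"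

text \<open>
  \<open>unpush d xs\<close> subtracts \<open>d\<close> from each element of the chain selected from above, except that it drops the
  lowest one, which \<open>bottom\<close> records. All others exceed \<open>d\<close>, so the subtraction does not truncate.
  A lowered element takes the position of the next lower chain element, since the entries between
  the two are within \<open>d\<close> of the higher one and hence not below its lowered value.
\<close>
fun unpush :: "nat \<Rightarrow> nat list \<Rightarrow> nat list" where
  "unpush d [] = []"
| "unpush d (x # xs) =
     (if xs = [] then []
      else if x + d < bottom d xs then (bottom d xs - d) # unpush d xs
      else x # unpush d xs)"

lemma push_not_Nil [simp]: "push d e xs \<noteq> []"
  by (cases xs) auto

lemma bottom_in_set: "xs \<noteq> [] \<Longrightarrow> bottom d xs \<in> set xs"
  by (induction xs) auto

lemma push_ge:
  assumes "L \<le> e" "\<forall>x\<in>set xs. L \<le> x" "y \<in> set (push d e xs)"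
  shows "L \<le> y"
  using assms by (induction d e xs rule: push.induct) (auto split: if_splits)

lemma sorted_push: "sorted xs \<Longrightarrow> sorted (push d e xs)"
proof (induction d e xs rule: push.induct)
  case (2 d e x xs)
  have xs: "sorted xs" "\<forall>y\<in>set xs. x \<le> y" using "2.prems" by auto
  show ?case
  proof (cases "x \<le> e")
    case True
    then show ?thesis using 2 xs push_ge[OF True xs(2)] by auto
  next
    case False
    then have "\<forall>y\<in>set xs. e \<le> y" "e \<le> x + d" using xs(2) by auto
    then show ?thesis using False 2 xs push_ge[of e "x + d" xs _ d] by auto
  qed
qed simp

text \<open>
  The elements shifted by \<open>push\<close> are those selected greedily from above: an entry \<open>x\<close> that is passed
  over satisfies \<open>x \<le> e \<le> x + d\<close>, so it is too close below \<open>e\<close> to join the chain, whereas an \<open>e\<close> that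
  is put down in front of \<open>x > e\<close> is at distance at least \<open>d + 1\<close> from the next chain element \<open>x + d\<close>.
  The second hypothesis says that \<open>e - d\<close> is the smallest element before the shift.
\<close>
lemma bottom_push_and_unpush_push:
  assumes "sorted xs" "\<forall>x\<in>set xs. e \<le> x + d"
  shows "bottom d (push d e xs) = e \<and> unpush d (push d e xs) = xs"
  using assms by (induction d e xs rule: push.induct) auto

lemmas bottom_push = bottom_push_and_unpush_push[THEN conjunct1]
lemmas unpush_push = bottom_push_and_unpush_push[THEN conjunct2]

lemma push_unpush:
  assumes "sorted ys" "ys \<noteq> []"
  shows "push d (bottom d ys) (unpush d ys) = ys"
  using assms
proof (induction ys)
  case (Cons x xs)
  then show ?case
    using bottom_in_set[of xs d] by auto
qed simp

lemma bottom_le_unpush: "y \<in> set (unpush d ys) \<Longrightarrow> bottom d ys \<le> y + d"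
  by (induction ys) (auto split: if_splits)

lemma unpush_ge:
  assumes "\<forall>x\<in>set ys. L \<le> x" "y \<in> set (unpush d ys)"
  shows "L \<le> y"
  using assms by (induction ys) (auto split: if_splits)

lemma sorted_unpush: "sorted ys \<Longrightarrow> sorted (unpush d ys)"
proof (induction ys)
  case (Cons x xs)
  then show ?case
    using bottom_le_unpush[of _ d xs] unpush_ge[of xs x _ d] by fastforce
qed simp

lemma chain_length_eq_0_iff [simp]: "chain_length d xs = 0 \<longleftrightarrow> xs = []"
  by (induction xs) auto

text \<open>
  The shift of the chain selected from below in \<open>(e - d) # xs\<close> becomes the chain selected from
  above, so the left-hand side counts the former, and the right-hand side counts the latter before the
  shift: it is \<open>chain_length d ((e - d) # xs)\<close>, written without the possibly negative entry. So the two
  greedy selections have equal length.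
\<close>
lemma chain_length_push_eq:
  assumes "sorted xs" "\<forall>x\<in>set xs. e \<le> x + d"
  shows "chain_length d (push d e xs) =
           (if xs = [] \<or> e < bottom d xs then Suc (chain_length d xs) else chain_length d xs)"
  using assms
proof (induction d e xs rule: push.induct)
  case (2 d e x xs)
  show ?case
  proof (cases "x \<le> e")
    case True
    then show ?thesis using 2 bottom_push[of xs e d] by auto
  next
    case False
    have "\<forall>y\<in>set xs. x + d \<le> y + d" using 2 by auto
    moreover have "xs = [] \<or> x \<le> bottom d xs" using 2 bottom_in_set[of xs d] by auto
    ultimately show ?thesis using False 2 bottom_push[of xs "x + d" d] by auto
  qed
qed auto

text \<open>
  Every element of the chain gains \<open>d\<close>; the summand \<open>d\<close> on the left accounts for the initial element
  \<open>e - d\<close>.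
\<close>
lemma sum_list_push:
  assumes "sorted xs" "\<forall>x\<in>set xs. e \<le> x + d"
  shows "sum_list (push d e xs) + d = e + sum_list xs + d * chain_length d (push d e xs)"
  using assms
proof (induction d e xs rule: push.induct)
  case (2 d e x xs)
  show ?case
  proof (cases "x \<le> e")
    case True
    then show ?thesis using 2 bottom_push[of xs e d] by auto
  next
    case False
    have "\<forall>y\<in>set xs. x + d \<le> y + d" using 2 by auto
    then show ?thesis using False 2 bottom_push[of xs "x + d" d] by auto
  qed
qed auto

definition count_cong :: "nat \<Rightarrow> nat \<Rightarrow> nat list \<Rightarrow> nat" where
  "count_cong i m xs = length (filter (\<lambda>x. [x = i] (mod m)) xs)"

lemma count_cong_push: "count_cong i d (push d e xs) = count_cong i d (e # xs)"
  by (induction d e xs rule: push.induct) (auto simp: count_cong_def cong_def)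

section \<open>Words\<close>

lemma words_Cons_iff:
  "x # w \<in> words k \<longleftrightarrow>
     (if w = [] then x = k \<and> 1 \<le> k else w \<in> words k \<and> 1 \<le> x \<and> x \<le> k \<and> (x = k \<longrightarrow> w \<noteq> [k]))"
proof (cases w)
  case (Cons y v)
  then show ?thesis
    by (cases v) (auto simp: words_def nth_Cons')
qed (auto simp: words_def)

text \<open>Prepending letters to \<open>[k]\<close> yields all words, if \<open>k\<close> is not prepended directly to \<open>[k]\<close>.\<close>
lemma words_induct [consumes 1, case_names single small large]:
  assumes "w \<in> words k"
    and "P [k]"
    and "\<And>x w. w \<in> words k \<Longrightarrow> P w \<Longrightarrow> 1 \<le> x \<Longrightarrow> x < k \<Longrightarrow> P (x # w)"
    and "\<And>w. w \<in> words k \<Longrightarrow> P w \<Longrightarrow> w \<noteq> [k] \<Longrightarrow> P (k # w)"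
  shows "P w"
  using assms(1)
proof (induction w)
  case Nil
  then show ?case by (simp add: words_def)
next
  case (Cons x w)
  then show ?case
    using assms(2-4) by (cases "x = k") (auto simp: words_Cons_iff split: if_splits)
qed

lemma ascents_Cons:
  assumes "w \<noteq> []"
  shows "ascents (x # w) = (if x < hd w then insert 1 (Suc ` ascents w) else Suc ` ascents w)"
proof (intro set_eqI)
  fix i
  show "i \<in> ascents (x # w) \<longleftrightarrow>
          i \<in> (if x < hd w then insert 1 (Suc ` ascents w) else Suc ` ascents w)"
  proof (cases i)
    case (Suc j)
    then show ?thesis using assms
      by (cases j) (auto simp: ascents_def hd_conv_nth image_iff)
  qed (auto simp: ascents_def)
qed

lemma finite_ascents [simp]: "finite (ascents w)"
  by (rule finite_subset[of _ "{..length w}"]) (auto simp: ascents_def)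

lemma ascents_single [simp]: "ascents [x] = {}"
  by (auto simp: ascents_def)

lemma one_notin_Suc_ascents [simp]: "Suc 0 \<notin> Suc ` ascents w"
  by (auto simp: ascents_def)

lemma asc_Cons:
  "w \<noteq> [] \<Longrightarrow> asc (x # w) = (if x < hd w then Suc (asc w) else asc w)"
  by (simp add: asc_def ascents_Cons card_image)

text \<open>
  All ascents move by one, and a possible new ascent is at position \<open>1\<close>, so each ascent of the longer
  word contributes \<open>1\<close> to the difference.
\<close>
lemma comaj_Cons: "w \<noteq> [] \<Longrightarrow> comaj (x # w) = comaj w + asc (x # w)"
  by (simp add: asc_def comaj_def ascents_Cons card_image sum.reindex sum_Suc)

section \<open>From words to lists of parts\<close>

text \<open>
  In the last case the letter is \<open>k = d + 1\<close>; the chain shift then starts with the smallest part \<open>c\<close>, which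
  \<open>push\<close> expects in its shifted form \<open>c + d\<close>.
\<close>
fun parts_of :: "nat \<Rightarrow> nat list \<Rightarrow> nat list" where
  "parts_of d [] = []"
| "parts_of d (x # w) =
     (if x \<le> d then push d x (parts_of d w)
      else (case parts_of d w of [] \<Rightarrow> [] | c # zs \<Rightarrow> push d (c + d) zs))"

definition part_lists :: "nat list set" where
  "part_lists = {xs. sorted xs \<and> 0 \<notin> set xs}"

lemma push_in_part_lists:
  assumes "xs \<in> part_lists" "1 \<le> e"
  shows "push d e xs \<in> part_lists"
proof -
  have "\<forall>x\<in>set xs. 1 \<le> x"
    using assms(1) unfolding part_lists_def by (metis (mono_tags) One_nat_def Suc_leI mem_Collect_eq neq0_conv)
  then have "1 \<le> y" if "y \<in> set (push d e xs)" for y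
    using push_ge[of 1 e xs y d] assms(2) that by blast
  then show ?thesis
    using assms(1) sorted_push[of xs d e] by (fastforce simp: part_lists_def)
qed

lemma part_lists_ConsD:
  assumes "c # zs \<in> part_lists"
  shows "zs \<in> part_lists" "sorted zs" "1 \<le> c + d" "\<forall>x\<in>set zs. c + d \<le> x + d"
  using assms by (auto simp: part_lists_def)

lemma part_lists_letter:
  assumes "xs \<in> part_lists" "x < Suc d"
  shows "sorted xs" "\<forall>y\<in>set xs. x \<le> y + d"
  using assms by (auto simp: part_lists_def)

lemma parts_of_in_part_lists:
  assumes "w \<in> words (Suc d)"
  shows "parts_of d w \<in> part_lists"
  using assms
proof (induction rule: words_induct)
  case single
  then show ?case by (simp add: part_lists_def)
next
  case (small x w)
  then show ?case by (simp add: push_in_part_lists)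
next
  case (large w)
  then show ?case
    using part_lists_ConsD(1,3) by (auto split: list.split intro!: push_in_part_lists)
qed

lemma parts_of_eq_Nil_iff:
  assumes "w \<in> words (Suc d)"
  shows "parts_of d w = [] \<longleftrightarrow> w = [Suc d]"
  using assms by (induction rule: words_induct) (auto simp: words_def split: list.split)

text \<open>
  The lowest element of the chain remembers the last letter that acted: \<open>x < k\<close> leaves \<open>x\<close> there, and
  \<open>k\<close> leaves \<open>c + d \<ge> k\<close>, where \<open>c\<close> was the smallest part.
\<close>
lemma bottom_parts_of:
  assumes "w \<in> words (Suc d)" "w \<noteq> [Suc d]"
  shows "min (Suc d) (bottom d (parts_of d w)) = hd w"
  using assms
proof (induction rule: words_induct)
  case (small x w)
  then show ?case
    using bottom_push[OF part_lists_letter[OF parts_of_in_part_lists]] by simp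
next
  case (large w)
  obtain c zs where czs: "parts_of d w = c # zs"
    using large parts_of_eq_Nil_iff by (meson neq_Nil_conv)
  have "c # zs \<in> part_lists"
    using parts_of_in_part_lists[OF large(1)] czs by simp
  then show ?case
    using czs bottom_push[OF part_lists_ConsD(2,4)] by (auto simp: part_lists_def)
qed simp

text \<open>
  The letter \<open>x < k\<close> lengthens the chain iff \<open>x\<close> is less than its lowest element, and by
  \<open>bottom_parts_of\<close> this is a comparison of \<open>x\<close> with the next letter.
\<close>
lemma chain_length_parts_of:
  assumes "w \<in> words (Suc d)"
  shows "chain_length d (parts_of d w) = asc w"
  using assms
proof (induction rule: words_induct)
  case single
  then show ?case by (simp add: asc_def)
next
  case (small x w)
  have "w \<noteq> []" using small(1) by (auto simp: words_def)
  moreover have "parts_of d w = [] \<or> x < bottom d (parts_of d w) \<longleftrightarrow> x < hd w"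
  proof (cases "w = [Suc d]")
    case True
    then show ?thesis using small by simp
  next
    case False
    then show ?thesis
      using small bottom_parts_of[of w d] parts_of_eq_Nil_iff[of w d] by auto
  qed
  ultimately show ?case
    using small chain_length_push_eq[OF part_lists_letter[OF parts_of_in_part_lists[OF small(1)] small(3)]]
    by (simp add: asc_Cons)
next
  case (large w)
  obtain c zs where czs: "parts_of d w = c # zs"
    using large parts_of_eq_Nil_iff by (meson neq_Nil_conv)
  have *: "c # zs \<in> part_lists"
    using parts_of_in_part_lists[OF large(1)] czs by simp
  have "w \<noteq> []" "hd w \<le> Suc d" using large(1) by (auto simp: words_def subset_iff)
  then show ?case
    using czs large chain_length_push_eq[OF part_lists_ConsD(2,4)[OF *], of d] by (simp add: asc_Cons)
qed

text \<open>The letters below \<open>k\<close> form a complete residue system modulo \<open>d\<close>, and \<open>push\<close> keeps residues.\<close>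
lemma count_cong_parts_of:
  assumes "w \<in> words (Suc d)" "1 \<le> i" "i \<le> d"
  shows "count_cong i d (parts_of d w) = count_list w i"
  using assms(1)
proof (induction rule: words_induct)
  case single
  then show ?case using assms(3) by (simp add: count_cong_def)
next
  case (small x w)
  have "[x = i] (mod d) \<longleftrightarrow> x = i"
    using small(2,3) assms(2,3) by (cases "x = d"; cases "i = d") (auto simp: cong_def)
  then show ?case
    using small by (simp add: count_cong_push) (simp add: count_cong_def)
next
  case (large w)
  then show ?case
    using assms(3) by (auto split: list.split simp: count_cong_push)
      (auto simp: count_cong_def cong_def split: if_splits)
qed

text \<open>
  A letter \<open>x < k\<close> adds \<open>x - d\<close> and then \<open>d\<close> times the length of the chain. The sum on the left
  compensates for \<open>x - d\<close>; there the truncated \<open>d - x\<close> is \<open>0\<close> for the letter \<open>k\<close>, as it should be.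
\<close>
lemma sum_list_parts_of:
  assumes "w \<in> words (Suc d)"
  shows "sum_list (parts_of d w) + (\<Sum>x\<leftarrow>w. d - x) = d * comaj w"
  using assms
proof (induction rule: words_induct)
  case single
  then show ?case by (simp add: comaj_def)
next
  case (small x w)
  have "w \<noteq> []" using small(1) by (auto simp: words_def)
  moreover from this have "x # w \<in> words (Suc d)"
    using small by (simp add: words_Cons_iff)
  ultimately show ?case
    using small chain_length_parts_of[of "x # w" d]
      sum_list_push[OF part_lists_letter[OF parts_of_in_part_lists[OF small(1)] small(3)]]
    by (simp add: comaj_Cons algebra_simps)
next
  case (large w)
  obtain c zs where czs: "parts_of d w = c # zs"
    using large parts_of_eq_Nil_iff by (meson neq_Nil_conv)
  have *: "c # zs \<in> part_lists"
    using parts_of_in_part_lists[OF large(1)] czs by simp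
  have "w \<noteq> []" using large(1) by (auto simp: words_def)
  moreover from this have "Suc d # w \<in> words (Suc d)"
    using large by (simp add: words_Cons_iff)
  ultimately show ?case
    using large czs chain_length_parts_of[of "Suc d # w" d]
      sum_list_push[OF part_lists_ConsD(2,4)[OF *], of d]
    by (simp add: comaj_Cons algebra_simps)
qed

text \<open>
  Undoing the action of the first letter. If that letter is \<open>k\<close>, the lowest chain element returns to the
  list of parts, lowered by \<open>d\<close>; otherwise it was created by the letter and disappears.
\<close>
lemma parts_of_letter:
  assumes "w \<in> words (Suc d)" "w \<noteq> [Suc d]"
  shows "\<exists>v\<in>words (Suc d). w = hd w # v \<and>
    (if hd w \<le> d then parts_of d v = unpush d (parts_of d w)
     else parts_of d v = (bottom d (parts_of d w) - d) # unpush d (parts_of d w))"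
  using assms
proof (induction rule: words_induct)
  case (small x w)
  then show ?case
    using unpush_push[OF part_lists_letter[OF parts_of_in_part_lists]] by auto
next
  case (large w)
  obtain c zs where czs: "parts_of d w = c # zs"
    using large parts_of_eq_Nil_iff by (meson neq_Nil_conv)
  have "c # zs \<in> part_lists"
    using parts_of_in_part_lists[OF large(1)] czs by simp
  then show ?case
    using czs large(1) bottom_push_and_unpush_push[OF part_lists_ConsD(2,4)] by auto
qed simp

lemma inj_on_parts_of: "inj_on (parts_of d) (words (Suc d))"
proof
  fix w w'
  assume "w \<in> words (Suc d)" "w' \<in> words (Suc d)" "parts_of d w = parts_of d w'"
  then show "w = w'"
  proof (induction w arbitrary: w' rule: length_induct)
    case (1 w)
    show ?case
    proof (cases "w = [Suc d]")
      case True
      then show ?thesis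
        using "1.prems" parts_of_eq_Nil_iff by metis
    next
      case False
      then have ne: "w' \<noteq> [Suc d]"
        using "1.prems" parts_of_eq_Nil_iff by metis
      have hd: "hd w = hd w'"
        using bottom_parts_of[OF "1.prems"(1) False] bottom_parts_of[OF "1.prems"(2) ne] "1.prems"(3)
        by simp
      obtain v where v: "v \<in> words (Suc d)" "w = hd w # v"
        "if hd w \<le> d then parts_of d v = unpush d (parts_of d w)
         else parts_of d v = (bottom d (parts_of d w) - d) # unpush d (parts_of d w)"
        using parts_of_letter[OF "1.prems"(1) False] by blast
      obtain v' where v': "v' \<in> words (Suc d)" "w' = hd w' # v'"
        "if hd w' \<le> d then parts_of d v' = unpush d (parts_of d w')
         else parts_of d v' = (bottom d (parts_of d w') - d) # unpush d (parts_of d w')"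
        using parts_of_letter[OF "1.prems"(2) ne] by blast
      have "parts_of d v = parts_of d v'"
        using v(3) v'(3) hd "1.prems"(3) by (auto split: if_splits)
      moreover have "length v < length w" by (subst v(2)) simp
      ultimately have "v = v'" using "1.IH" v(1) v'(1) by blast
      then show ?thesis using v(2) v'(2) hd by simp
    qed
  qed
qed

text \<open>
  Undoing a chain shift lowers the sum, since \<open>d \<ge> 1\<close>. The lowest chain element \<open>b\<close> determines the letter
  that must be undone: it is \<open>b\<close> if \<open>b < k\<close>, and \<open>k\<close> otherwise.
\<close>
lemma parts_of_surj:
  assumes "1 \<le> d" "ys \<in> part_lists"
  shows "\<exists>w\<in>words (Suc d). parts_of d w = ys"
  using assms(2)
proof (induction "sum_list ys" arbitrary: ys rule: less_induct)
  case less
  show ?case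
  proof (cases "ys = []")
    case True
    have "[Suc d] \<in> words (Suc d)" by (simp add: words_Cons_iff)
    then show ?thesis using True by force
  next
    case False
    define b zs where "b = bottom d ys" and "zs = unpush d ys"
    have sorted: "sorted ys" and pos: "\<forall>y\<in>set ys. 1 \<le> y"
      using less.prems by (auto simp: part_lists_def Suc_le_eq intro: gr0I)
    have ys: "push d b zs = ys"
      using push_unpush[OF sorted False] by (simp add: b_def zs_def)
    have zs: "zs \<in> part_lists" "sorted zs" "\<forall>z\<in>set zs. b \<le> z + d"
      using sorted_unpush[OF sorted] unpush_ge[OF pos] bottom_le_unpush
      by (fastforce simp: part_lists_def zs_def b_def)+
    have b: "1 \<le> b"
      using bottom_in_set[OF False] pos by (auto simp: b_def)
    \<comment> \<open>The shift has added \<open>d\<close> at least once, which pays for the \<open>d\<close> in \<open>sum_list_push\<close>.\<close>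
    have "chain_length d ys \<noteq> 0"
      using False by simp
    then have "d \<le> d * chain_length d ys" by (cases "chain_length d ys") auto
    then have sum: "b + sum_list zs \<le> sum_list ys"
      using sum_list_push[OF zs(2,3)] unfolding ys by linarith
    show ?thesis
    proof (cases "b \<le> d")
      case True
      obtain w where "w \<in> words (Suc d)" "parts_of d w = zs"
        using less.hyps[OF _ zs(1)] sum b by auto
      moreover from this have "w \<noteq> []" by (auto simp: words_def)
      ultimately have "b # w \<in> words (Suc d)" "parts_of d (b # w) = ys"
        using True b ys by (auto simp: words_Cons_iff)
      then show ?thesis by blast
    next
      case big: False
      have "(b - d) # zs \<in> part_lists"
        using zs big by (auto simp: part_lists_def)
      moreover have "sum_list ((b - d) # zs) < sum_list ys"
        using sum big assms(1) by simp
      ultimately obtain w where w: "w \<in> words (Suc d)" "parts_of d w = (b - d) # zs"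
        using less.hyps by blast
      then have "w \<noteq> [Suc d]" "w \<noteq> []" by auto
      then have "Suc d # w \<in> words (Suc d)" "parts_of d (Suc d # w) = ys"
        using w big ys by (auto simp: words_Cons_iff)
      then show ?thesis by blast
    qed
  qed
qed

lemma bij_betw_parts_of: "1 \<le> d \<Longrightarrow> bij_betw (parts_of d) (words (Suc d)) part_lists"
  using inj_on_parts_of parts_of_surj parts_of_in_part_lists
  by (fastforce simp: bij_betw_def)

section \<open>Partitions as lists of parts\<close>

text \<open>
  The lists are ascending and partitions descending, so that \<open>of_parts (x # xs)\<close> extends \<open>of_parts xs\<close> by
  a smallest part at a new index, and inductions on the list match admissible index lists that grow at
  their end.
\<close>
definition of_parts :: "nat list \<Rightarrow> nat \<Rightarrow> nat" where
  "of_parts xs j = (if j < length xs then rev xs ! j else 0)"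

lemma of_parts_Cons: "of_parts (x # xs) = (of_parts xs)(length xs := x)"
  by (auto simp: of_parts_def fun_eq_iff nth_append)

lemma support_of_parts:
  assumes "xs \<in> part_lists"
  shows "{j. of_parts xs j \<noteq> 0} = {..<length xs}"
proof -
  have "rev xs ! j \<noteq> 0" if "j < length xs" for j
    using assms nth_mem[of j "rev xs"] that unfolding part_lists_def
    by (metis (mono_tags, lifting) length_rev mem_Collect_eq set_rev)
  then show ?thesis by (auto simp: of_parts_def)
qed

lemma of_parts_in_partitions:
  assumes "xs \<in> part_lists"
  shows "of_parts xs \<in> partitions"
proof -
  have "of_parts xs j \<le> of_parts xs i" if "i \<le> j" for i j
  proof -
    have "sorted_wrt (\<ge>) (rev xs)"
      using assms by (simp add: part_lists_def sorted_wrt_rev)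
    then show ?thesis
      using that sorted_wrt_nth_less[of "(\<ge>)" "rev xs" i j]
      by (cases "i = j") (auto simp: of_parts_def)
  qed
  then show ?thesis
    using support_of_parts[OF assms] by (auto simp: partitions_def intro: antimonoI)
qed

lemma bij_betw_of_parts: "bij_betw of_parts part_lists partitions"
proof (rule bij_betw_imageI)
  show "inj_on of_parts part_lists"
  proof
    fix xs ys
    assume *: "xs \<in> part_lists" "ys \<in> part_lists" "of_parts xs = of_parts ys"
    then have "{..<length xs} = {..<length ys}"
      using support_of_parts by metis
    then have len: "length xs = length ys" by simp
    have "rev xs = rev ys"
    proof (rule nth_equalityI)
      fix i assume "i < length (rev xs)"
      then show "rev xs ! i = rev ys ! i"
        using len fun_cong[OF *(3), of i] by (simp add: of_parts_def)
    qed (simp add: len)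
    then show "xs = ys" by simp
  qed
next
  have "l \<in> of_parts ` part_lists" if "l \<in> partitions" for l
  proof -
    have anti: "antimono l" and fin: "finite {i. l i \<noteq> 0}"
      using that by (auto simp: partitions_def)
    obtain n where n: "\<forall>i. l i \<noteq> 0 \<longleftrightarrow> i < n"
    proof
      define n where "n = (LEAST n. l n = 0)"
      have "\<exists>n. l n = 0"
        using fin infinite_UNIV_nat by (metis (mono_tags) UNIV_eq_I mem_Collect_eq)
      then have "l n = 0" unfolding n_def by (rule LeastI_ex)
      then have "l i = 0" if "n \<le> i" for i
        using antimonoD[OF anti that] by simp
      moreover have "l i \<noteq> 0" if "i < n" for i
        using not_less_Least[of i "\<lambda>n. l n = 0"] that by (simp add: n_def)
      ultimately show "\<forall>i. l i \<noteq> 0 \<longleftrightarrow> i < n" by (meson not_le)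
    qed
    define xs where "xs = rev (map l [0..<n])"
    have "sorted_wrt (\<lambda>i j. l j \<le> l i) [0..<n]"
      by (rule sorted_wrt_mono_rel[OF _ sorted_upt]) (rule antimonoD[OF anti])
    then have "sorted xs"
      by (simp add: xs_def sorted_wrt_rev sorted_wrt_map)
    moreover have "0 \<notin> set xs"
    proof
      assume "0 \<in> set xs"
      then obtain i where "i < n" "l i = 0" by (auto simp: xs_def)
      then show False using n by blast
    qed
    ultimately have "xs \<in> part_lists" by (simp add: part_lists_def)
    moreover have "of_parts xs = l"
      using n by (auto simp: of_parts_def xs_def fun_eq_iff)
    ultimately show ?thesis by blast
  qed
  then show "of_parts ` part_lists = partitions"
    using of_parts_in_partitions by blast
qed

lemma psize_of_parts:
  assumes "xs \<in> part_lists"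
  shows "psize (of_parts xs) = sum_list xs"
proof -
  have "psize (of_parts xs) = (\<Sum>j<length (rev xs). rev xs ! j)"
    unfolding psize_def support_of_parts[OF assms] by (simp add: of_parts_def)
  also have "\<dots> = sum_list (rev xs)"
    by (simp add: sum_list_sum_nth atLeast0LessThan)
  finally show ?thesis by simp
qed

lemma num_parts_cong_of_parts:
  assumes "xs \<in> part_lists"
  shows "num_parts_cong i m (of_parts xs) = count_cong i m xs"
proof -
  have "{j. of_parts xs j \<noteq> 0 \<and> [of_parts xs j = i] (mod m)} =
        {j. j < length (rev xs) \<and> [rev xs ! j = i] (mod m)}"
  proof (intro Collect_cong)
    fix j
    have "of_parts xs j \<noteq> 0 \<longleftrightarrow> j < length xs"
      using support_of_parts[OF assms] by blast
    then show "of_parts xs j \<noteq> 0 \<and> [of_parts xs j = i] (mod m) \<longleftrightarrow>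
        j < length (rev xs) \<and> [rev xs ! j = i] (mod m)"
      by (cases "j < length xs") (simp_all add: of_parts_def)
  qed
  then have "num_parts_cong i m (of_parts xs) = length (filter (\<lambda>x. [x = i] (mod m)) (rev xs))"
    by (simp add: num_parts_cong_def length_filter_conv_card)
  then show ?thesis by (simp add: count_cong_def flip: rev_filter)
qed

text \<open>
  The gap condition is transitive, so it may be imposed on all pairs instead of neighbours; in this
  form it is compatible with appending an index.
\<close>
lemma k_admissible_iff:
  "k_admissible k l js \<longleftrightarrow>
     sorted_wrt (\<lambda>i j. i < j \<and> l j + k \<le> l i) js \<and> (\<forall>j\<in>set js. l j \<noteq> 0)"
proof -
  have "transp (\<lambda>i j. i < j \<and> l j + k \<le> l i)" by (rule transpI) auto
  moreover have "transp ((<) :: nat \<Rightarrow> nat \<Rightarrow> bool)" by (rule transpI) auto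
  ultimately show ?thesis
    by (auto simp: k_admissible_def sorted_wrt_iff_nth_Suc_transp)
qed

lemma k_admissible_cong:
  assumes "k_admissible k l js" "\<And>j. j \<in> set js \<Longrightarrow> l' j = l j"
  shows "k_admissible k l' js"
  using assms by (simp add: k_admissible_def)

text \<open>
  Selecting greedily from above is optimal. The induction needs the stronger claim that
  among the chains of maximal length the greedy one has the largest lowest element, so no other chain
  leaves more room for a further part below it.
\<close>
lemma k_admissible_bound:
  assumes "sorted xs" "k_admissible (Suc d) (of_parts xs) js"
  shows "length js \<le> chain_length d xs \<and>
    (js \<noteq> [] \<longrightarrow> length js = chain_length d xs \<longrightarrow> of_parts xs (last js) \<le> bottom d xs)"
  using assms
proof (induction xs arbitrary: js)
  case Nil
  then show ?case by (cases js) (auto simp: k_admissible_iff of_parts_def)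
next
  case (Cons x xs)
  let ?n = "length xs"
  have adm: "k_admissible (Suc d) ((of_parts xs)(?n := x)) js"
    using Cons.prems(2) unfolding of_parts_Cons .
  have restrict: "k_admissible (Suc d) (of_parts xs) is"
    if "k_admissible (Suc d) ((of_parts xs)(?n := x)) is" "?n \<notin> set is" for "is"
    using that by (elim k_admissible_cong) auto
  have less: "j \<le> ?n" if "j \<in> set js" for j
    using adm that by (auto simp: k_admissible_iff of_parts_def split: if_splits)
  have x_le: "xs \<noteq> [] \<Longrightarrow> x \<le> bottom d xs"
    using Cons.prems(1) bottom_in_set[of xs d] by auto
  show ?case
  proof (cases "?n \<in> set js")
    case False
    have IH: "length js \<le> chain_length d xs"
      "js \<noteq> [] \<Longrightarrow> length js = chain_length d xs \<Longrightarrow> of_parts xs (last js) \<le> bottom d xs"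
      using Cons.IH[OF _ restrict[OF adm False]] Cons.prems(1) by auto
    have "js \<noteq> [] \<Longrightarrow> last js \<noteq> ?n" using False by (metis last_in_set)
    then show ?thesis using IH by (auto simp: of_parts_Cons)
  next
    case True
    obtain js' m where js: "js = js' @ [m]"
      using True by (metis append_butlast_last_id empty_iff list.set(1))
    have m: "m = ?n"
      using True js adm less[of m] by (fastforce simp: k_admissible_iff sorted_wrt_append)
    have notin: "?n \<notin> set js'"
      using adm js m by (auto simp: k_admissible_iff sorted_wrt_append)
    have adm': "k_admissible (Suc d) ((of_parts xs)(?n := x)) js'"
      using adm js by (auto simp: k_admissible_iff sorted_wrt_append)
    have IH: "length js' \<le> chain_length d xs"
      "js' \<noteq> [] \<Longrightarrow> length js' = chain_length d xs \<Longrightarrow> of_parts xs (last js') \<le> bottom d xs"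
      using Cons.IH[OF _ restrict[OF adm' notin]] Cons.prems(1) by auto
    have gap: "x + d < of_parts xs (last js')" if "js' \<noteq> []"
    proof -
      have "last js' \<in> set js'" using that by simp
      moreover from this have "last js' \<noteq> ?n" using notin by metis
      ultimately show ?thesis
        using adm js m by (auto simp: k_admissible_iff sorted_wrt_append)
    qed
    have full: "xs = [] \<or> x + d < bottom d xs" if "length js' = chain_length d xs"
    proof (cases "js' = []")
      case True
      then have "chain_length d xs = 0" using that by simp
      then show ?thesis by simp
    next
      case False
      then show ?thesis using gap IH(2) that by fastforce
    qed
    show ?thesis
      using IH(1) full x_le js m
      by (cases "length js' = chain_length d xs") (auto simp: of_parts_Cons)
  qed
qed

text \<open>
  The greedy selection itself is an admissible chain. That \<open>bottom\<close> bounds its elements from below is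
  what allows it to be extended.
\<close>
lemma k_admissible_greedy:
  assumes "xs \<in> part_lists"
  shows "\<exists>js. k_admissible (Suc d) (of_parts xs) js \<and> length js = chain_length d xs \<and>
    (xs \<noteq> [] \<longrightarrow> js \<noteq> [] \<and> (\<forall>j\<in>set js. bottom d xs \<le> of_parts xs j))"
  using assms
proof (induction xs)
  case Nil
  then show ?case by (auto simp: k_admissible_iff)
next
  case (Cons x xs)
  let ?n = "length xs"
  have xs: "xs \<in> part_lists" using Cons.prems by (auto simp: part_lists_def)
  obtain js where js: "k_admissible (Suc d) (of_parts xs) js" "length js = chain_length d xs"
    "xs \<noteq> [] \<Longrightarrow> js \<noteq> [] \<and> (\<forall>j\<in>set js. bottom d xs \<le> of_parts xs j)"
    using Cons.IH[OF xs] by blast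
  have less: "j < ?n" if "j \<in> set js" for j
    using js(1) that by (auto simp: k_admissible_iff of_parts_def split: if_splits)
  then have upd: "of_parts (x # xs) j = of_parts xs j" if "j \<in> set js" for j
    using that by (auto simp: of_parts_Cons)
  have adm: "k_admissible (Suc d) (of_parts (x # xs)) js"
    using js(1) upd by (rule k_admissible_cong)
  show ?case
  proof (cases "xs = [] \<or> x + d < bottom d xs")
    case True
    have "x \<noteq> 0" using Cons.prems by (auto simp: part_lists_def)
    moreover have "x + d < of_parts xs j" if "j \<in> set js" for j
      using True js(3) less that by fastforce
    ultimately have "k_admissible (Suc d) (of_parts (x # xs)) (js @ [?n])"
      using adm less upd by (auto simp: k_admissible_iff sorted_wrt_append of_parts_Cons Suc_le_eq)
    moreover have "x \<le> of_parts (x # xs) j" if "j \<in> set (js @ [?n])" for j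
      using that upd \<open>\<And>j. j \<in> set js \<Longrightarrow> x + d < of_parts xs j\<close>
      by (fastforce simp: of_parts_Cons)
    ultimately show ?thesis using True js(2) by (intro exI[of _ "js @ [?n]"]) auto
  next
    case False
    then show ?thesis using adm js upd by (intro exI[of _ js]) auto
  qed
qed

lemma k_measure_of_parts:
  assumes "xs \<in> part_lists"
  shows "k_measure (Suc d) (of_parts xs) = chain_length d xs"
  unfolding k_measure_def
proof (rule Max_eqI)
  have "sorted xs" using assms by (simp add: part_lists_def)
  then have bound: "length js \<le> chain_length d xs" if "k_admissible (Suc d) (of_parts xs) js" for js
    using k_admissible_bound that by blast
  then show "finite {length js |js. k_admissible (Suc d) (of_parts xs) js}"
    by (auto intro: finite_subset[of _ "{..chain_length d xs}"])
  show "m \<le> chain_length d xs"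
    if "m \<in> {length js |js. k_admissible (Suc d) (of_parts xs) js}" for m
    using that bound by auto
  show "chain_length d xs \<in> {length js |js. k_admissible (Suc d) (of_parts xs) js}"
    using k_admissible_greedy[OF assms, of d] by force
qed

section \<open>The bijection\<close>

lemma sum_deficit_eq_sum_count:
  assumes "0 \<notin> set w"
  shows "(\<Sum>x\<leftarrow>w. d - x) = (\<Sum>i = 1..d - 1. (d - i) * count_list w i)"
proof -
  have "(\<Sum>x\<leftarrow>w. d - x) = (\<Sum>i\<in>set w. (d - i) * count_list w i)"
    by (simp add: sum_list_map_eq_sum_count mult.commute)
  also have "\<dots> = (\<Sum>i = 1..d - 1. (d - i) * count_list w i)"
  proof (rule sum.mono_neutral_cong)
    show "(d - i) * count_list w i = 0" if "i \<in> {1..d - 1} - set w" for i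
      using that by (simp add: count_list_0_iff)
    show "(d - i) * count_list w i = 0" if "i \<in> set w - {1..d - 1}" for i
      using that assms by (cases "i = 0") auto
  qed auto
  finally show ?thesis .
qed

theorem theorem1p7:
  fixes k :: nat
  assumes "k \<ge> 2"
  shows "\<exists>\<Omega> :: (nat \<Rightarrow> nat) \<Rightarrow> nat list.
           bij_betw \<Omega> partitions (words k) \<and>
           (\<forall>l\<in>partitions.
              (\<forall>i. 1 \<le> i \<and> i < k \<longrightarrow> num_parts_cong i (k - 1) l = count_list (\<Omega> l) i) \<and>
              int (psize l) = (int k - 1) * int (comaj (\<Omega> l))
                 - (\<Sum>i = 1..k - 2. (int k - 1 - int i) * int (count_list (\<Omega> l) i)) \<and>
              k_measure k l = asc (\<Omega> l))"
proof -
  define d where "d = k - 1"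
  have d: "k = Suc d" "1 \<le> d" using assms by (auto simp: d_def)
  define \<Phi> where "\<Phi> = of_parts \<circ> parts_of d"
  define \<Omega> where "\<Omega> = inv_into (words k) \<Phi>"
  have bij: "bij_betw \<Phi> (words k) partitions"
    unfolding \<Phi>_def d(1) using bij_betw_parts_of[OF d(2)] bij_betw_of_parts by (rule bij_betw_trans)
  have "(\<forall>i. 1 \<le> i \<and> i < k \<longrightarrow> num_parts_cong i (k - 1) l = count_list (\<Omega> l) i) \<and>
        int (psize l) = (int k - 1) * int (comaj (\<Omega> l))
           - (\<Sum>i = 1..k - 2. (int k - 1 - int i) * int (count_list (\<Omega> l) i)) \<and>
        k_measure k l = asc (\<Omega> l)" if "l \<in> partitions" for l
  proof -
    define w where "w = \<Omega> l"
    have w: "w \<in> words (Suc d)"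
      using bij_betw_apply[OF bij_betw_inv_into[OF bij] that] d by (simp add: w_def \<Omega>_def)
    have "\<Phi> w = l"
      using bij_betw_inv_into_right[OF bij that] by (simp add: w_def \<Omega>_def)
    then have l: "l = of_parts (parts_of d w)" by (simp add: \<Phi>_def)
    note parts = parts_of_in_part_lists[OF w]
    have "num_parts_cong i (k - 1) l = count_list w i" if "1 \<le> i" "i < k" for i
      using that count_cong_parts_of[OF w] num_parts_cong_of_parts[OF parts] by (simp add: l d(1))
    moreover have "int (psize l) = (int k - 1) * int (comaj w)
           - (\<Sum>i = 1..k - 2. (int k - 1 - int i) * int (count_list w i))"
    proof -
      have "0 \<notin> set w" using w by (auto simp: words_def)
      then have "psize l + (\<Sum>i = 1..d - 1. (d - i) * count_list w i) = d * comaj w"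
        using sum_list_parts_of[OF w] psize_of_parts[OF parts] sum_deficit_eq_sum_count[of w d]
        by (simp add: l)
      then have "int (psize l) + int (\<Sum>i = 1..d - 1. (d - i) * count_list w i) = int d * int (comaj w)"
        by (metis of_nat_add of_nat_mult)
      moreover have "int (\<Sum>i = 1..d - 1. (d - i) * count_list w i) =
          (\<Sum>i = 1..k - 2. (int k - 1 - int i) * int (count_list w i))"
        unfolding of_nat_sum using d by (intro sum.cong) (auto simp: of_nat_diff)
      ultimately show ?thesis using d(1) by simp
    qed
    moreover have "k_measure k l = asc w"
      using k_measure_of_parts[OF parts] chain_length_parts_of[OF w] by (simp add: l d(1))
    ultimately show ?thesis by (simp add: w_def)
  qed
  moreover have "bij_betw \<Omega> partitions (words k)"
    unfolding \<Omega>_def using bij by (rule bij_betw_inv_into)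
  ultimately show ?thesis by blast
qed

end
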